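(* Let $q$ and $r$ be odd primes such that $r$ divides $q-1$, and let $G$ denote the nonabelian group of order $qr$. Then all elements of order $r$ in $G$ lie in the same endomorphism class, but these elements fall into $r-1$ different automorphism classes.
   Context: For a group $G$, two elements $x,y$ lie in the same endomorphism class if some endomorphism of $G$ maps $x$ to $y$ and some endomorphism of $G$ maps $y$ to $x$ (this is an equivalence relation on $G$, whose equivalence classes are the endomorphism classes). The automorphism classes are the orbits of $\operatorname{Aut}(G)$ on $G$. *)

theory Defs
  imports "HOL-Algebra.Algebra"
begin

definition endo_rel :: "('a, 'b) monoid_scheme \<Rightarrow> ('a \<times> 'a) set" where
  "endo_rel G = {(x, y). x \<in> carrier G \<and> y \<in> carrier G \<and>
     (\<exists>f \<in> hom G G. f x = y) \<and> (\<exists>f \<in> hom G G. f y = x)}"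

lemma equiv_endo_rel: "equiv (carrier G) (endo_rel G)"
  for G :: "('a, 'b) monoid_scheme"
proof (rule equivI)
  show "endo_rel G \<subseteq> carrier G \<times> carrier G"
    by (auto simp: endo_rel_def)
  show "refl_on (carrier G) (endo_rel G)"
    by (auto simp: refl_on_def endo_rel_def intro!: bexI[where x = "\<lambda>x. x"] homI)
  show "sym (endo_rel G)"
    by (auto simp: sym_def endo_rel_def)
  show "trans (endo_rel G)"
  proof (rule transI)
    fix x y z
    assume xy: "(x, y) \<in> endo_rel G" and yz: "(y, z) \<in> endo_rel G"
    have step: "\<exists>h \<in> hom G G. h a = c"
      if "f \<in> hom G G" "g \<in> hom G G" "f a = b" "g b = c" for f g :: "'a \<Rightarrow> 'a" and a b c
      using that by (intro bexI[where x = "g \<circ> f"] Group.hom_compose) auto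
    from xy yz show "(x, z) \<in> endo_rel G"
      unfolding endo_rel_def by (auto dest: step)
  qed
qed

definition endo_classes :: "('a, 'b) monoid_scheme \<Rightarrow> 'a set set" where
  "endo_classes G = carrier G // endo_rel G"

text \<open>The elements of \<^term>\<open>AutoGroup G\<close> are themselves functions on the carrier, so the
  natural action is given by the identity map.\<close>

definition auto_classes :: "('a, 'b) monoid_scheme \<Rightarrow> 'a set set" where
  "auto_classes G = orbits (AutoGroup G) (carrier G) (\<lambda>f. f)"

end

theory Submission
  imports Defs
begin

text \<open>
  Write \<open>Q\<close> for a subgroup of order \<open>q\<close>. Since \<open>r < q\<close>, a second such subgroup \<open>Q'\<close> would give
  \<open>q * q > q * r\<close> distinct products, so \<open>Q\<close> is the only one and hence is stable under all
  automorphisms; in particular it is normal. Everything else rests on one observation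
  (\<open>comm_group_if_commutes_with_prime_subgroup\<close>): as \<open>Q\<close> has prime order and prime index and \<open>G\<close>
  is not abelian, no element outside \<open>Q\<close> commutes with a nontrivial element of \<open>Q\<close>. For \<open>y\<close>
  outside \<open>Q\<close> the power \<open>y [^] r\<close> lies in \<open>Q\<close> and commutes with \<open>y\<close>, so it is trivial: the elements
  of order \<open>r\<close> are exactly those outside \<open>Q\<close>.

  Endomorphism classes: if \<open>x\<close> has order \<open>r\<close>, then \<open>G\<close> is the semidirect product of \<open>Q\<close> and the
  powers of \<open>x\<close>, so for every \<open>y\<close> of order \<open>r\<close> killing \<open>Q\<close> and sending \<open>x\<close> to \<open>y\<close> defines an
  endomorphism.

  Automorphism classes: an automorphism \<open>f\<close> fixes every coset of \<open>Q\<close>. Indeed conjugation by \<open>x\<close>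
  raises each element of the cyclic group \<open>Q\<close> to one and the same power, and applying \<open>f\<close> shows that
  conjugation by \<open>f x\<close> uses the same exponent; thus \<open>inv x \<otimes> f x\<close> centralizes \<open>Q\<close> and lies in \<open>Q\<close>.
  Conversely, for \<open>x\<close> outside \<open>Q\<close> the \<open>q\<close> conjugates of \<open>x\<close> by elements of \<open>Q\<close> are distinct and
  lie in \<open>Q #> x\<close>, so they fill it. The automorphism classes of elements of order \<open>r\<close> are therefore
  the \<open>r - 1\<close> cosets of \<open>Q\<close> other than \<open>Q\<close>.
\<close>

section \<open>Subgroups of prime order and prime index\<close>

context group
begin

lemma card_subgroup_dvd:
  assumes "subgroup J G" "subgroup H G" "J \<subseteq> H"
  shows "card J dvd card H"
proof -
  interpret H: group "G\<lparr>carrier := H\<rparr>"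
    using assms(2) by (rule subgroup_imp_group)
  have "subgroup J (G\<lparr>carrier := H\<rparr>)"
    using assms by (rule subgroup_incl)
  then have "card J dvd order (G\<lparr>carrier := H\<rparr>)"
    by (metis H.lagrange dvd_triv_right)
  then show ?thesis
    by (simp add: order_def)
qed

lemma subgroup_of_prime_order_subgroup:
  assumes "subgroup J G" "subgroup H G" "J \<subseteq> H" "Factorial_Ring.prime (card H)"
  shows "J = {\<one>} \<or> J = H"
proof -
  have fin: "finite H"
    using assms(4) card_ge_0_finite prime_gt_0_nat by blast
  have "card J = 1 \<or> card J = card H"
    using card_subgroup_dvd[OF assms(1-3)] assms(4) by (simp add: prime_nat_iff)
  then show ?thesis
  proof
    assume "card J = 1"
    then show ?thesis
      using subgroup.one_closed[OF assms(1)] by (auto simp: card_1_singleton_iff)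
  next
    assume "card J = card H"
    then show ?thesis
      using card_subset_eq[OF fin assms(3)] by simp
  qed
qed

lemma prime_order_subgroup_subset:
  assumes "subgroup H G" "Factorial_Ring.prime (card H)" "subgroup J G" "a \<in> H" "a \<in> J" "a \<noteq> \<one>"
  shows "H \<subseteq> J"
proof -
  have "subgroup (H \<inter> J) G"
    using assms(1,3) by (rule subgroups_Inter_pair)
  then have "H \<inter> J = {\<one>} \<or> H \<inter> J = H"
    using assms(1,2) by (intro subgroup_of_prime_order_subgroup) auto
  with assms(4-6) show ?thesis by auto
qed

lemma prime_index_subgroup_maximal:
  assumes fin: "finite (carrier G)"
    and H: "subgroup H G" and K: "subgroup K G" and HK: "H \<subseteq> K"
    and index: "Factorial_Ring.prime (card (rcosets H))"
    and y: "y \<in> K" "y \<notin> H"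
  shows "K = carrier G"
proof -
  have posH: "card H > 0"
    using H fin by (rule subgroup.finite_imp_card_positive)
  obtain m where m: "card K = card H * m"
    using card_subgroup_dvd[OF H K HK] by blast
  have "card (rcosets K) * (card H * m) = card (rcosets H) * card H"
    using lagrange[OF H] lagrange[OF K] m by simp
  then have "card (rcosets K) * m = card (rcosets H)"
    using posH by (simp add: mult.assoc[symmetric] mult.commute[of _ "card H"])
  then have "m = 1 \<or> m = card (rcosets H)"
    using index by (metis dvd_triv_right prime_nat_iff)
  moreover have "finite K"
    using K fin by (meson subgroup.subset finite_subset)
  then have "m \<noteq> 1"
    using m card_subset_eq[OF _ HK] y by auto
  ultimately have "card K = card (carrier G)"
    using m lagrange[OF H] by (simp add: order_def mult.commute)
  then show ?thesis
    using card_subset_eq[OF fin subgroup.subset[OF K]] by simp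
qed

lemma subgroup_centralizer:
  assumes "a \<in> carrier G"
  shows "subgroup {g \<in> carrier G. g \<otimes> a = a \<otimes> g} G"
proof (rule subgroupI)
  fix g h assume "g \<in> {g \<in> carrier G. g \<otimes> a = a \<otimes> g}" "h \<in> {g \<in> carrier G. g \<otimes> a = a \<otimes> g}"
  then show "g \<otimes> h \<in> {g \<in> carrier G. g \<otimes> a = a \<otimes> g}"
    using assms by (auto simp: m_assoc) (metis m_assoc)
next
  fix g assume "g \<in> {g \<in> carrier G. g \<otimes> a = a \<otimes> g}"
  then have g: "g \<in> carrier G" and comm: "g \<otimes> a = a \<otimes> g"
    by auto
  have "inv g \<otimes> a = inv g \<otimes> (a \<otimes> g) \<otimes> inv g"
    using g assms by (simp add: m_assoc)
  also have "\<dots> = a \<otimes> inv g"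
    unfolding comm[symmetric] using g assms by (simp add: m_assoc[symmetric])
  finally show "inv g \<in> {g \<in> carrier G. g \<otimes> a = a \<otimes> g}"
    using g by simp
qed (use assms in auto)

text \<open>
  The argument runs through centralizers. A centralizer that contains a nontrivial element of \<open>H\<close>
  contains \<open>H\<close>, and one that contains \<open>H\<close> and \<open>y\<close> is the whole group. The first fact makes \<open>H\<close>
  abelian and centralized by \<open>y\<close>; the second then makes central first the elements of \<open>H\<close>, then \<open>y\<close>,
  and finally every element.
\<close>

lemma comm_group_if_commutes_with_prime_subgroup:
  assumes fin: "finite (carrier G)"
    and H: "subgroup H G" "Factorial_Ring.prime (card H)" "Factorial_Ring.prime (card (rcosets H))"
    and y: "y \<in> carrier G" "y \<notin> H"
    and a: "a \<in> H" "a \<noteq> \<one>" "a \<otimes> y = y \<otimes> a"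
  shows "comm_group G"
proof -
  let ?C = "\<lambda>g. {h \<in> carrier G. h \<otimes> g = g \<otimes> h}"
  have sub: "h \<in> carrier G" if "h \<in> H" for h
    using H(1) that by (rule subgroup.mem_carrier)
  have small: "H \<subseteq> ?C g" if "b \<in> H" "b \<noteq> \<one>" "g \<in> carrier G" "b \<otimes> g = g \<otimes> b" for b g
    using that sub by (intro prime_order_subgroup_subset[OF H(1,2) subgroup_centralizer]) auto
  have large: "?C g = carrier G" if "H \<subseteq> ?C g" "y \<otimes> g = g \<otimes> y" "g \<in> carrier G" for g
    using that y by (intro prime_index_subgroup_maximal[OF fin H(1) subgroup_centralizer _ H(3)]) auto
  have Hy: "H \<subseteq> ?C y"
    using small a y(1) by blast
  have "?C h = carrier G" if "h \<in> H" for h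
  proof (cases "h = \<one>")
    case False
    have "H \<subseteq> ?C h"
      using small[of h h] that False sub by simp
    then show ?thesis
      using Hy that sub by (intro large) auto
  qed auto
  then have H_central: "g \<otimes> h = h \<otimes> g" if "h \<in> H" "g \<in> carrier G" for h g
    using that by blast
  have "?C y = carrier G"
    using Hy y(1) by (intro large) auto
  then have y_central: "g \<otimes> y = y \<otimes> g" if "g \<in> carrier G" for g
    using that by blast
  have "?C g = carrier G" if "g \<in> carrier G" for g
  proof (rule large[OF _ y_central[OF that, symmetric] that])
    show "H \<subseteq> ?C g"
      using H_central[OF _ that] sub by auto
  qed
  then have "x \<otimes> z = z \<otimes> x" if "x \<in> carrier G" "z \<in> carrier G" for x z
    using that by blast
  then show ?thesis
    by (rule group_comm_groupI)
qed

lemma card_prod_le_order_if_trivial_Int: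
  assumes fin: "finite (carrier G)" and H: "subgroup H G" and K: "subgroup K G"
    and HK: "H \<inter> K = {\<one>}"
  shows "card H * card K \<le> order G"
proof -
  have "inj_on (\<lambda>(h, k). h \<otimes> k) (H \<times> K)"
  proof (rule inj_onI, clarsimp)
    fix h k h' k' assume *: "h \<in> H" "k \<in> K" "h' \<in> H" "k' \<in> K" "h \<otimes> k = h' \<otimes> k'"
    note carr = *(1,3)[THEN subgroup.mem_carrier[OF H]] *(2,4)[THEN subgroup.mem_carrier[OF K]]
    have "inv h' \<otimes> h = k' \<otimes> inv k"
      using carr *(5) by (metis inv_closed inv_solve_left inv_solve_right m_assoc m_closed)
    moreover have "inv h' \<otimes> h \<in> H" "k' \<otimes> inv k \<in> K"
      using * H K by (auto simp: subgroup.m_closed subgroup.m_inv_closed)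
    ultimately have "inv h' \<otimes> h = \<one>" "k' \<otimes> inv k = \<one>"
      using HK by auto
    then show "h = h' \<and> k = k'"
      using carr by (metis inv_closed inv_equality inv_inv)
  qed
  then have "card H * card K = card ((\<lambda>(h, k). h \<otimes> k) ` (H \<times> K))"
    by (simp add: card_image card_cartesian_product)
  also have "\<dots> \<le> order G"
    unfolding order_def using H K
    by (intro card_mono[OF fin]) (auto simp: subgroup.mem_carrier)
  finally show ?thesis .
qed

lemma conjugation_in_auto:
  assumes "g \<in> carrier G"
  shows "(\<lambda>h\<in>carrier G. g \<otimes> h \<otimes> inv g) \<in> auto G"
proof -
  have "(\<lambda>h\<in>carrier G. g \<otimes> h \<otimes> inv g) \<in> hom G G"
  proof (rule homI)
    fix h k assume "h \<in> carrier G" "k \<in> carrier G"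
    moreover from this have "inv g \<otimes> (g \<otimes> (k \<otimes> inv g)) = k \<otimes> inv g"
      using assms by (simp add: m_assoc[symmetric])
    ultimately show "(\<lambda>h\<in>carrier G. g \<otimes> h \<otimes> inv g) (h \<otimes> k)
      = (\<lambda>h\<in>carrier G. g \<otimes> h \<otimes> inv g) h \<otimes> (\<lambda>h\<in>carrier G. g \<otimes> h \<otimes> inv g) k"
      using assms by (simp add: m_assoc)
  qed (use assms in auto)
  then show ?thesis
    using conjugation_is_bij[OF assms] by (simp add: auto_def Bij_def)
qed

end

section \<open>Endomorphisms of a split cyclic extension\<close>

text \<open>
  Here \<open>G\<close> is the semidirect product of \<open>H\<close> and the powers of \<open>x\<close>, so it retracts onto the cyclic
  group generated by \<open>x\<close> with kernel \<open>H\<close>, and this group maps to \<open>G\<close> by \<open>x \<mapsto> y\<close>. The coset of \<open>g\<close> determines the exponent \<open>k\<close> with \<open>g \<in> H #> x [^] k\<close> only up to multiples of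
  \<open>ord x\<close>, which is harmless because \<open>y [^] k\<close> has the same ambiguity.
\<close>

lemma (in normal) endomorphism_of_cyclic_complement:
  assumes x: "x \<in> carrier G" and y: "y \<in> carrier G"
    and cover: "\<And>g. g \<in> carrier G \<Longrightarrow> \<exists>k::int. g \<in> H #> x [^] k"
    and triv: "\<And>k::int. x [^] k \<in> H \<Longrightarrow> x [^] k = \<one>"
    and ord: "ord y dvd ord x"
  shows "\<exists>f \<in> hom G G. f x = y"
proof -
  define e :: "'a \<Rightarrow> int" where "e g = (SOME k. g \<in> H #> x [^] k)" for g
  have e: "g \<in> H #> x [^] e g" if "g \<in> carrier G" for g
    unfolding e_def using someI_ex[OF cover[OF that]] .
  have indep: "y [^] i = y [^] j" if "g \<in> H #> x [^] i" "g \<in> H #> x [^] j" for g and i j :: int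
  proof -
    have "H #> x [^] i = H #> x [^] j"
      using that x repr_independence[OF _ _ is_subgroup] by (metis int_pow_closed)
    then have "x [^] i \<in> H #> x [^] j"
      using x rcos_self[OF _ is_subgroup] by (metis int_pow_closed)
    then have "x [^] i \<otimes> inv (x [^] j) \<in> H"
      using x rcos_module[OF is_group] by simp
    then have "x [^] (i - j) = \<one>"
      using triv[of "i - j"] x by (simp add: int_pow_diff)
    then have "int (ord y) dvd i - j"
      using x ord by (meson dvd_trans int_dvd_int_iff int_pow_eq_id)
    then show ?thesis
      using y by (metis int_pow_eq)
  qed
  have "(\<lambda>g. y [^] e g) \<in> hom G G"
  proof (rule homI)
    fix g h assume gh: "g \<in> carrier G" "h \<in> carrier G"
    have "g \<otimes> h \<in> (H #> x [^] e g) <#> (H #> x [^] e h)"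
      using e gh by (auto simp: set_mult_def)
    also have "\<dots> = H #> x [^] (e g + e h)"
      using x by (simp add: rcos_sum int_pow_mult)
    finally have "y [^] e (g \<otimes> h) = y [^] (e g + e h)"
      using indep e gh by blast
    then show "y [^] e (g \<otimes> h) = y [^] e g \<otimes> y [^] e h"
      using y by (simp add: int_pow_mult)
  qed (use y in auto)
  moreover have "y [^] e x = y [^] (1::int)"
    using x by (intro indep[OF e]) (auto simp: rcos_self is_subgroup)
  ultimately show ?thesis
    using y by (intro bexI[of _ "\<lambda>g. y [^] e g"]) auto
qed

section \<open>Nonabelian groups of order a product of two primes\<close>

locale nonabelian_two_primes = group G for G (structure) +
  fixes q r :: nat and Q
  assumes prime_q: "Factorial_Ring.prime q" and prime_r: "Factorial_Ring.prime r"
    and r_less_q: "r < q"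
    and noncomm: "\<not> comm_group G"
    and order: "order G = q * r"
    and subgroup_Q: "subgroup Q G" and card_Q: "card Q = q"
begin

lemma fin: "finite (carrier G)"
  using order prime_q prime_r by (metis mult_pos_pos order_gt_0_iff_finite prime_gt_0_nat)

lemma finite_Q: "finite Q"
  using subgroup_Q fin by (meson subgroup.subset finite_subset)

lemma mem_carrier_Q: "u \<in> Q \<Longrightarrow> u \<in> carrier G"
  using subgroup_Q by (rule subgroup.mem_carrier)

lemma index_Q: "card (rcosets Q) = r"
  using lagrange[OF subgroup_Q] order card_Q prime_gt_0_nat[OF prime_q] by simp

lemma not_commutes:
  assumes "y \<in> carrier G" "y \<notin> Q" "a \<in> Q" "a \<noteq> \<one>"
  shows "a \<otimes> y \<noteq> y \<otimes> a"
proof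
  assume "a \<otimes> y = y \<otimes> a"
  then have "comm_group G"
    using assms prime_q prime_r
    by (intro comm_group_if_commutes_with_prime_subgroup[OF fin subgroup_Q, of y a])
       (simp_all only: card_Q index_Q not_False_eq_True)
  with noncomm show False ..
qed

lemma subgroup_order_q_unique:
  assumes "subgroup K G" "card K = q"
  shows "K = Q"
proof (rule ccontr)
  assume "K \<noteq> Q"
  then have "\<not> Q \<subseteq> K"
    using assms(2) card_Q fin card_subset_eq[of K Q] subgroup.subset[OF assms(1)]
    by (metis finite_subset)
  then have "Q \<inter> K = {\<one>}"
    using prime_order_subgroup_subset[OF subgroup_Q _ assms(1)] prime_q card_Q
      subgroup.one_closed[OF assms(1)] subgroup.one_closed[OF subgroup_Q] by auto
  then have "q * q \<le> q * r"
    using card_prod_le_order_if_trivial_Int[OF fin subgroup_Q assms(1)] assms(2) card_Q order by simp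
  with r_less_q show False by simp
qed

lemma auto_image_Q:
  assumes "f \<in> auto G"
  shows "f ` Q = Q"
proof (rule subgroup_order_q_unique)
  interpret f: group_hom G G f
    using assms by unfold_locales (simp add: auto_def)
  show "subgroup (f ` Q) G"
    using subgroup_Q by (rule f.subgroup_img_is_subgroup)
  have "inj_on f Q"
    using assms subgroup.subset[OF subgroup_Q]
    by (auto simp: auto_def Bij_def bij_betw_def intro: inj_on_subset)
  then show "card (f ` Q) = q"
    by (simp add: card_image card_Q)
qed

sublocale Q: normal Q G
  unfolding normal_inv_iff
proof (intro conjI ballI subgroup_Q)
  fix x h assume x: "x \<in> carrier G" and h: "h \<in> Q"
  have "(\<lambda>h\<in>carrier G. x \<otimes> h \<otimes> inv x) h \<in> Q"
    using auto_image_Q[OF conjugation_in_auto[OF x]] h by blast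
  then show "x \<otimes> h \<otimes> inv x \<in> Q"
    using mem_carrier_Q[OF h] by simp
qed

text \<open>Elements of \<open>Q\<close> have order dividing \<open>q\<close>. For \<open>y\<close> outside \<open>Q\<close>, the power \<open>y [^] r\<close> lies in \<open>Q\<close>
  because the quotient has order \<open>r\<close>, and it commutes with \<open>y\<close>.\<close>

lemma ord_eq_r_iff:
  assumes "y \<in> carrier G"
  shows "ord y = r \<longleftrightarrow> y \<notin> Q"
proof
  assume r: "ord y = r"
  show "y \<notin> Q"
  proof
    assume "y \<in> Q"
    then have "generate G {y} \<subseteq> Q"
      using generate_subgroup_incl[OF _ subgroup_Q] by simp
    then have "ord y dvd q"
      using card_subgroup_dvd[OF generate_is_subgroup subgroup_Q, of "{y}"] assms
      by (simp add: generate_pow_card card_Q)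
    then have "r = q"
      using r prime_q prime_r primes_dvd_imp_eq by blast
    with r_less_q show False by simp
  qed
next
  assume y: "y \<notin> Q"
  interpret M: group "G Mod Q"
    by (rule Q.factorgroup_is_group)
  have "order (G Mod Q) = r"
    by (simp add: order_def FactGroup_def index_Q)
  then have "(Q #> y) [^]\<^bsub>G Mod Q\<^esub> r = \<one>\<^bsub>G Mod Q\<^esub>"
    using M.pow_order_eq_1[of "Q #> y"] assms by (auto simp: FactGroup_def RCOSETS_def)
  then have "Q #> y [^] r = Q"
    using Q.FactGroup_pow[OF assms] by simp
  then have yr: "y [^] r \<in> Q"
    using assms by (intro coset_join1[OF _ _ subgroup_Q]) auto
  have "y [^] r \<otimes> y = y \<otimes> y [^] r"
    using assms by (metis nat_pow_Suc nat_pow_Suc2)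
  then have "y [^] r = \<one>"
    using not_commutes[OF assms y yr] by blast
  then have "ord y dvd r"
    using assms pow_eq_id by blast
  moreover have "ord y \<noteq> 1"
    using y ord_eq_1[OF assms] subgroup.one_closed[OF subgroup_Q] by auto
  ultimately show "ord y = r"
    using prime_r by (auto simp: prime_nat_iff)
qed

section \<open>The endomorphism class\<close>

text \<open>The union of the cosets of the powers of \<open>x\<close> is a subgroup strictly larger than \<open>Q\<close>, which is
  maximal.\<close>

lemma cosets_of_powers_cover:
  assumes x: "x \<in> carrier G" "x \<notin> Q" and g: "g \<in> carrier G"
  shows "\<exists>k::int. g \<in> Q #> x [^] k"
proof -
  let ?K = "{g \<in> carrier G. \<exists>k::int. g \<in> Q #> x [^] k}"
  have x_in: "x \<in> ?K"
    using rcos_self[OF x(1) subgroup_Q] x(1) int_pow_1[OF x(1)] by (metis (mono_tags, lifting) mem_Collect_eq)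
  have "subgroup ?K G"
  proof (rule subgroupI)
    show "?K \<noteq> {}"
      using x_in by blast
  next
    fix a assume "a \<in> ?K"
    then obtain k :: int where k: "a \<in> carrier G" "a \<in> Q #> x [^] k" by blast
    have "Q #> a = Q #> x [^] k"
      using k x repr_independence[OF _ _ subgroup_Q] by (metis int_pow_closed)
    then have "Q #> inv a = Q #> x [^] (- k)"
      using k x Q.rcos_inv[of a] Q.rcos_inv[of "x [^] k"] by (simp add: int_pow_neg)
    then show "inv a \<in> ?K"
      using k rcos_self[OF _ subgroup_Q, of "inv a"] by auto
  next
    fix a b assume "a \<in> ?K" "b \<in> ?K"
    then obtain k l :: int where kl: "a \<in> carrier G" "a \<in> Q #> x [^] k"
      "b \<in> carrier G" "b \<in> Q #> x [^] l" by blast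
    have "a \<otimes> b \<in> (Q #> x [^] k) <#> (Q #> x [^] l)"
      using kl by (auto simp: set_mult_def)
    also have "\<dots> = Q #> x [^] (k + l)"
      using x by (simp add: Q.rcos_sum int_pow_mult)
    finally show "a \<otimes> b \<in> ?K"
      using kl by auto
  qed auto
  moreover have "Q \<subseteq> ?K"
    using mem_carrier_Q by (auto intro!: exI[of _ "0::int"] simp: coset_mult_one[OF Q.subset])
  moreover note x_in
  ultimately have "?K = carrier G"
    using prime_index_subgroup_maximal[OF fin subgroup_Q _ _ _ _ x(2)] index_Q prime_r by blast
  with g show ?thesis by blast
qed

text \<open>A power of \<open>x\<close> that lies in \<open>Q\<close> commutes with \<open>x\<close>, hence is trivial; so the powers of \<open>x\<close>
  form a complement of \<open>Q\<close>.\<close>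

lemma endomorphism_between_order_r:
  assumes x: "x \<in> carrier G" "ord x = r" and y: "y \<in> carrier G" "ord y = r"
  shows "\<exists>f \<in> hom G G. f x = y"
proof (rule Q.endomorphism_of_cyclic_complement[OF x(1) y(1)])
  show "\<exists>k::int. g \<in> Q #> x [^] k" if "g \<in> carrier G" for g
    using cosets_of_powers_cover x ord_eq_r_iff that by blast
  show "x [^] k = \<one>" if "x [^] k \<in> Q" for k :: int
  proof (rule ccontr)
    assume "x [^] k \<noteq> \<one>"
    moreover have "x [^] k \<otimes> x = x \<otimes> x [^] k"
      using x(1) by (metis int_pow_1 int_pow_mult add.commute)
    ultimately show False
      using not_commutes[of x "x [^] k"] that x ord_eq_r_iff by blast
  qed
qed (simp add: x y)

lemma order_r_in_endo_class:
  "\<exists>C \<in> endo_classes G. {x \<in> carrier G. ord x = r} \<subseteq> C"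
proof -
  have "Q \<noteq> carrier G"
    using card_Q order r_less_q prime_gt_1_nat[OF prime_r] by (auto simp: order_def)
  then obtain x where x: "x \<in> carrier G" "ord x = r"
    using Q.subset ord_eq_r_iff by blast
  have "{y \<in> carrier G. ord y = r} \<subseteq> endo_rel G `` {x}"
    using x endomorphism_between_order_r by (auto simp: endo_rel_def)
  then show ?thesis
    using x(1) unfolding endo_classes_def by (meson quotientI)
qed

section \<open>The automorphism classes\<close>

text \<open>
  Conjugation by \<open>x\<close> is a power map on the cyclic group \<open>Q\<close>, and a power map commutes with every
  homomorphism. Transporting it along \<open>f\<close> therefore leaves it unchanged, which says that \<open>x\<close> and
  \<open>f x\<close> act alike on \<open>Q\<close> and so differ by an element of its centralizer, which is \<open>Q\<close> itself.
\<close>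

lemma auto_preserves_cosets:
  assumes f: "f \<in> auto G" and x: "x \<in> carrier G"
  shows "f x \<in> Q #> x"
proof -
  interpret f: group_hom G G f
    using f by unfold_locales (simp add: auto_def)
  obtain a where a: "a \<in> Q" "a \<noteq> \<one>"
    using card_Q prime_gt_1_nat[OF prime_q] subgroup.one_closed[OF subgroup_Q]
    by (metis less_numeral_extra(4) is_singletonI' is_singleton_altdef empty_iff)
  have ac: "a \<in> carrier G" using a mem_carrier_Q by blast
  have gen: "Q \<subseteq> generate G {a}"
    using a ac prime_q card_Q
    by (intro prime_order_subgroup_subset[OF subgroup_Q _ generate_is_subgroup, of _ a])
       (auto intro: generate.incl)
  have pow: "\<exists>k::int. v = a [^] k" if "v \<in> Q" for v
    using gen that generate_pow[OF ac] by auto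
  obtain k :: int where k: "x \<otimes> a \<otimes> inv x = a [^] k"
    using pow[OF Q.inv_op_closed2[OF x a(1)]] by blast
  have fa: "f a \<in> Q" "f a \<in> carrier G"
    using auto_image_Q[OF f] a mem_carrier_Q by blast+
  have inj: "inj_on f (carrier G)"
    using f by (auto simp: auto_def Bij_def bij_betw_def)
  have fa1: "f a \<noteq> \<one>"
    using inj_onD[OF inj, of a \<one>] a(2) ac by auto
  have fx: "f x \<in> carrier G" using x by simp
  \<comment> \<open>Conjugation by \<open>f x\<close> and by \<open>x\<close> both send \<open>f a\<close> to its \<open>k\<close>-th power.\<close>
  have conj_fx: "f x \<otimes> f a \<otimes> inv (f x) = f a [^] k"
    using arg_cong[OF k, of f] x ac by (simp add: f.hom_int_pow)
  obtain m :: int where m: "f a = a [^] m"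
    using pow[OF fa(1)] by blast
  interpret c: group_hom G G "\<lambda>h\<in>carrier G. x \<otimes> h \<otimes> inv x"
    using conjugation_in_auto[OF x] by unfold_locales (simp add: auto_def)
  have "x \<otimes> f a \<otimes> inv x = (x \<otimes> a \<otimes> inv x) [^] m"
    using c.hom_int_pow[OF ac, of m] ac m by simp
  also have "\<dots> = f a [^] k"
    using ac by (simp add: k m int_pow_pow mult.commute)
  finally have eq: "x \<otimes> f a \<otimes> inv x = f x \<otimes> f a \<otimes> inv (f x)"
    using conj_fx by simp
  let ?z = "inv x \<otimes> f x"
  have "f a \<otimes> ?z = inv x \<otimes> (x \<otimes> f a \<otimes> inv x) \<otimes> f x"
    using x fx fa by (simp add: m_assoc inv_solve_left)
  also have "\<dots> = ?z \<otimes> f a"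
    unfolding eq using x fx fa by (simp add: m_assoc)
  finally have "?z \<in> Q"
    using not_commutes[OF _ _ fa(1) fa1, of ?z] x fx by auto
  then have "x \<otimes> ?z \<otimes> inv x \<in> Q"
    using Q.inv_op_closed2[OF x] by blast
  then have "f x \<otimes> inv x \<in> Q"
    using x fx by (simp add: m_assoc[symmetric])
  then show ?thesis
    using Q.rcos_module[OF is_group x fx] by simp
qed

text \<open>Two elements of \<open>Q\<close> conjugating \<open>x\<close> to the same element differ by an element of \<open>Q\<close> commuting
  with \<open>x\<close>, so they are equal; the conjugates are as many as the elements of the coset.\<close>

lemma conjugates_fill_coset:
  assumes x: "x \<in> carrier G" "x \<notin> Q"
  shows "(\<lambda>u. u \<otimes> x \<otimes> inv u) ` Q = Q #> x"
proof (rule card_subset_eq)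
  have coset: "Q #> x \<in> rcosets Q"
    using x(1) by (intro rcosetsI Q.subset)
  show "finite (Q #> x)"
    using rcosets_finite[OF coset Q.subset finite_Q] .
  show "(\<lambda>u. u \<otimes> x \<otimes> inv u) ` Q \<subseteq> Q #> x"
  proof clarify
    fix u assume u: "u \<in> Q"
    have "u \<otimes> x \<otimes> inv u = (\<lambda>h\<in>carrier G. u \<otimes> h \<otimes> inv u) x"
      using x by simp
    also have "\<dots> \<in> Q #> x"
      by (rule auto_preserves_cosets[OF conjugation_in_auto[OF mem_carrier_Q[OF u]] x(1)])
    finally show "u \<otimes> x \<otimes> inv u \<in> Q #> x" .
  qed
  have "inj_on (\<lambda>u. u \<otimes> x \<otimes> inv u) Q"
  proof (rule inj_onI)
    fix u v assume uv: "u \<in> Q" "v \<in> Q" and eq: "u \<otimes> x \<otimes> inv u = v \<otimes> x \<otimes> inv v"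
    note c = uv[THEN mem_carrier_Q] x(1)
    let ?w = "inv v \<otimes> u"
    have "?w \<otimes> x = inv v \<otimes> (u \<otimes> x \<otimes> inv u) \<otimes> u"
      using c by (simp add: m_assoc)
    also have "\<dots> = x \<otimes> ?w"
      unfolding eq using c by (simp add: m_assoc[symmetric])
    finally have "?w = \<one>"
      using not_commutes[OF x, of ?w] uv Q.m_closed Q.m_inv_closed by blast
    then show "u = v"
      using c by (metis inv_closed inv_equality inv_inv)
  qed
  then show "card ((\<lambda>u. u \<otimes> x \<otimes> inv u) ` Q) = card (Q #> x)"
    using card_rcosets_equal[OF coset Q.subset] by (simp add: card_image)
qed

lemma auto_orbit_subset_coset:
  assumes "x \<in> carrier G"
  shows "orbit (AutoGroup G) (\<lambda>f. f) x \<subseteq> Q #> x"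
proof
  fix y assume "y \<in> orbit (AutoGroup G) (\<lambda>f. f) x"
  then obtain f where "f \<in> auto G" "y = f x"
    unfolding orbit_def AutoGroup_def by fastforce
  then show "y \<in> Q #> x"
    using auto_preserves_cosets[OF _ assms] by simp
qed

lemma auto_orbit_eq_coset:
  assumes x: "x \<in> carrier G" "x \<notin> Q"
  shows "orbit (AutoGroup G) (\<lambda>f. f) x = Q #> x"
proof (rule antisym[OF auto_orbit_subset_coset[OF x(1)]])
  have "u \<otimes> x \<otimes> inv u \<in> orbit (AutoGroup G) (\<lambda>f. f) x" if "u \<in> Q" for u
    using conjugation_in_auto[OF mem_carrier_Q[OF that]] x(1)
    by (auto simp: orbit_def AutoGroup_def intro!: exI[of _ "\<lambda>h\<in>carrier G. u \<otimes> h \<otimes> inv u"])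
  then show "Q #> x \<subseteq> orbit (AutoGroup G) (\<lambda>f. f) x"
    unfolding conjugates_fill_coset[OF x, symmetric] by blast
qed

lemma auto_classes_of_order_r:
  "{A \<in> auto_classes G. A \<inter> {x \<in> carrier G. ord x = r} \<noteq> {}} = rcosets Q - {Q}"
proof (intro equalityI subsetI)
  fix A assume "A \<in> {A \<in> auto_classes G. A \<inter> {x \<in> carrier G. ord x = r} \<noteq> {}}"
  then obtain x y where x: "x \<in> carrier G" "A = orbit (AutoGroup G) (\<lambda>f. f) x"
    and y: "y \<in> A" "y \<in> carrier G" "ord y = r"
    by (auto simp: auto_classes_def orbits_def)
  have "y \<in> Q #> x"
    using auto_orbit_subset_coset x y by blast
  moreover have "y \<notin> Q"
    using y ord_eq_r_iff by blast
  ultimately have "x \<notin> Q"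
    using coset_join2[OF x(1) subgroup_Q] by blast
  then have "A = Q #> x"
    using auto_orbit_eq_coset x by blast
  with \<open>y \<notin> Q\<close> y(1) show "A \<in> rcosets Q - {Q}"
    using rcosetsI[OF Q.subset x(1)] by blast
next
  fix A assume A: "A \<in> rcosets Q - {Q}"
  then obtain x where x: "x \<in> carrier G" "A = Q #> x"
    by (auto simp: RCOSETS_def)
  then have "x \<notin> Q"
    using A coset_join2[OF x(1) subgroup_Q] by blast
  then have "A = orbit (AutoGroup G) (\<lambda>f. f) x" "ord x = r"
    using auto_orbit_eq_coset ord_eq_r_iff x by auto
  then show "A \<in> {A \<in> auto_classes G. A \<inter> {x \<in> carrier G. ord x = r} \<noteq> {}}"
    using x rcos_self[OF x(1) subgroup_Q] unfolding auto_classes_def orbits_def by blast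
qed

lemma card_auto_classes_of_order_r:
  "card {A \<in> auto_classes G. A \<inter> {x \<in> carrier G. ord x = r} \<noteq> {}} = r - 1"
proof -
  have "Q \<in> rcosets Q"
    using rcosetsI[OF Q.subset one_closed] coset_mult_one[OF Q.subset] by simp
  then show ?thesis
    by (simp add: auto_classes_of_order_r index_Q)
qed

end

section \<open>Endomorphism and automorphism classes of the elements of order \<open>r\<close>\<close>

theorem proposition9p4:
  fixes G :: "('a, 'b) monoid_scheme" and q r :: nat
  assumes "Factorial_Ring.prime q" and "odd q"
    and "Factorial_Ring.prime r" and "odd r"
    and "r dvd q - 1"
    and "group G" and "\<not> comm_group G" and "order G = q * r"
  shows "(\<exists>C \<in> endo_classes G. {x \<in> carrier G. group.ord G x = r} \<subseteq> C) \<and>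
    card {A \<in> auto_classes G. A \<inter> {x \<in> carrier G. group.ord G x = r} \<noteq> {}} = r - 1"
proof -
  interpret group G by fact
  have q: "q > 1" using assms(1) by (rule prime_gt_1_nat)
  have "r < q"
    using dvd_imp_le[OF assms(5)] q by simp
  have "finite (carrier G)"
    using assms(1,3,8) by (metis mult_pos_pos order_gt_0_iff_finite prime_gt_0_nat)
  then obtain Q where "subgroup Q G" "card Q = q"
    using sylow_thm[of q G 1 r] assms by auto
  then interpret nonabelian_two_primes G q r Q
    using assms \<open>r < q\<close> by (intro nonabelian_two_primes.intro nonabelian_two_primes_axioms.intro)
  show ?thesis
    using order_r_in_endo_class card_auto_classes_of_order_r by blast
qed

end
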